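(* Fix a decision point with history $h_u$, a behavior policy $\pi_b(\cdot\mid h_u)$, an integer $n\ge 2$ and fixed integers $c_1,\dots,c_n\ge 1$. Let $C=\sum_{k=1}^n c_k$. Let $a_1,\dots,a_n$ be sampled independently from $\pi_b(\cdot\mid h_u)$, and, for each $k$, let $R_{k,1},\dots,R_{k,c_k}$ be the terminal rewards of $c_k$ independent rollouts of action $a_k$ from history $h_u$ under the continuation distribution $D_b$. For each $k$ let $$\hat Q^{D_b}(h_u,a_k)=\frac1{c_k}\sum_{m=1}^{c_k}R_{k,m},$$ and for each $j\in\{1,\dots,n\}$ let $$b_{-j}=\frac{1}{C-c_j}\sum_{k\neq j}c_k\,\hat Q^{D_b}(h_u,a_k),\qquad \hat A_j=\hat Q^{D_b}(h_u,a_j)-b_{-j}.$$ Then, under $D_b$, for every $j$ the leave-one-out advantage $\hat A_j$ is an unbiased estimate of the target advantage $A^*_{D_b}(h_u,a_j)=Q^{D_b}(h_u,a_j)-V^{D_b}(h_u)$, that is, $$\mathbb E\bigl[\hat A_j\mid h_u,a_j\bigr]=Q^{D_b}(h_u,a_j)-V^{D_b}(h_u),$$ where the expectation is over the rollout outcomes and the sampling of the actions $a_k$, $k\ne j$.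
   Context: Setting: several agents act sequentially in an episode; at a decision point $u$ the acting agent sees a history $h_u$ and selects an action $a$. At the end of the episode $\tau$ a real-valued terminal reward $R(\tau)$ is received. The history $h_u$ is fixed throughout. Behavior policy: $\pi_b(\cdot\mid h_u)$ is a fixed (frozen) probability distribution on the action space. Continuation distribution $D_b$: for each action $a$, restoring history $h_u$, injecting $a$, and letting all subsequent agents act according to $\pi_b$ until the episode ends induces a probability distribution of the terminal reward $R(\tau)$ on $\mathbb R$, depending on $(h_u,a)$. A "rollout of $a$ from $h_u$ under $D_b$" is a sample from this distribution. Values: $Q^{D_b}(h_u,a)=\mathbb E_{D_b}[R(\tau)\mid h_u,a]$ is the mean of that reward distribution, and $V^{D_b}(h_u)=\mathbb E_{a'\sim\pi_b(\cdot\mid h_u)}[Q^{D_b}(h_u,a')]$. Sampling conventions: the rollout counts $c_1,\dots,c_n$ are deterministic, fixed before any actions or rewards are observed (non-adaptive allocation). Given the actions $a_1,\dots,a_n$, all the rewards $R_{k,m}$ are independent, with $R_{k,m}$ distributed according to the $D_b$-reward distribution of $(h_u,a_k)$. Rewards are integrable, i.e. $\mathbb E|R_{k,m}|<\infty$, so all the expectations above exist. *)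

theory Defs
  imports "HOL-Probability.Probability"
begin

text \<open>
  The continuation is given as a reward kernel: \<open>D h a\<close> is the law of the terminal reward of an
  episode that is restored at history \<open>h\<close>, has action \<open>a\<close> injected, and is then played to its end
  under the behavior policy.
\<close>

definition Q_value :: "('h \<Rightarrow> 'a \<Rightarrow> real measure) \<Rightarrow> 'h \<Rightarrow> 'a \<Rightarrow> real" where
  "Q_value D h a = (\<integral>r. r \<partial>D h a)"

definition V_value :: "('h \<Rightarrow> 'a measure) \<Rightarrow> ('h \<Rightarrow> 'a \<Rightarrow> real measure) \<Rightarrow> 'h \<Rightarrow> real" where
  "V_value \<pi> D h = (\<integral>a. Q_value D h a \<partial>\<pi> h)"

definition target_advantage ::
    "('h \<Rightarrow> 'a measure) \<Rightarrow> ('h \<Rightarrow> 'a \<Rightarrow> real measure) \<Rightarrow> 'h \<Rightarrow> 'a \<Rightarrow> real" where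
  "target_advantage \<pi> D h a = Q_value D h a - V_value \<pi> D h"

definition Q_hat :: "(nat \<Rightarrow> nat) \<Rightarrow> (nat \<Rightarrow> nat \<Rightarrow> 'w \<Rightarrow> real) \<Rightarrow> nat \<Rightarrow> 'w \<Rightarrow> real" where
  "Q_hat c R k \<omega> = (1 / real (c k)) * (\<Sum>m = 1..c k. R k m \<omega>)"

definition total_count :: "nat \<Rightarrow> (nat \<Rightarrow> nat) \<Rightarrow> nat" where
  "total_count n c = (\<Sum>k = 1..n. c k)"

definition loo_baseline ::
    "nat \<Rightarrow> (nat \<Rightarrow> nat) \<Rightarrow> (nat \<Rightarrow> nat \<Rightarrow> 'w \<Rightarrow> real) \<Rightarrow> nat \<Rightarrow> 'w \<Rightarrow> real" where
  "loo_baseline n c R j \<omega> =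
     (1 / (real (total_count n c) - real (c j))) * (\<Sum>k\<in>{1..n} - {j}. real (c k) * Q_hat c R k \<omega>)"

definition loo_advantage ::
    "nat \<Rightarrow> (nat \<Rightarrow> nat) \<Rightarrow> (nat \<Rightarrow> nat \<Rightarrow> 'w \<Rightarrow> real) \<Rightarrow> nat \<Rightarrow> 'w \<Rightarrow> real" where
  "loo_advantage n c R j \<omega> = Q_hat c R j \<omega> - loo_baseline n c R j \<omega>"

text \<open>
  Conditional expectation given a random variable \<open>X\<close> with values in \<open>N\<close>, that is, given the
  sigma-algebra generated by \<open>X\<close>; as usual it is determined only almost surely.
\<close>

definition cond_exp_given ::
    "'w measure \<Rightarrow> 'b measure \<Rightarrow> ('w \<Rightarrow> 'b) \<Rightarrow> ('w \<Rightarrow> real) \<Rightarrow> 'w \<Rightarrow> real" where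
  "cond_exp_given M N X Y = real_cond_exp M (vimage_algebra (space M) X N) Y"

text \<open>
  Given all the actions \<open>act 1, \<dots>, act n\<close>, the rewards \<open>R k m\<close> are independent and \<open>R k m\<close> has law
  \<open>K (act k)\<close>: the conditional probability that every \<open>R k m\<close> lies in \<open>B k m\<close> is almost surely the
  product of the probabilities under these laws.
\<close>

definition independent_rollouts_given_actions ::
    "'w measure \<Rightarrow> 'a measure \<Rightarrow> ('a \<Rightarrow> real measure) \<Rightarrow> nat \<Rightarrow> (nat \<Rightarrow> nat)
      \<Rightarrow> (nat \<Rightarrow> 'w \<Rightarrow> 'a) \<Rightarrow> (nat \<Rightarrow> nat \<Rightarrow> 'w \<Rightarrow> real) \<Rightarrow> bool" where
  "independent_rollouts_given_actions M A K n c act R \<longleftrightarrow>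
     (\<forall>B :: nat \<Rightarrow> nat \<Rightarrow> real set.
        (\<forall>k\<in>{1..n}. \<forall>m\<in>{1..c k}. B k m \<in> sets borel) \<longrightarrow>
        (AE \<omega> in M.
           cond_exp_given M (Pi\<^sub>M {1..n} (\<lambda>_. A)) (\<lambda>\<omega>'. \<lambda>k\<in>{1..n}. act k \<omega>')
             (indicator {\<omega>' \<in> space M. \<forall>k\<in>{1..n}. \<forall>m\<in>{1..c k}. R k m \<omega>' \<in> B k m}) \<omega>
           = (\<Prod>k = 1..n. \<Prod>m = 1..c k. measure (K (act k \<omega>)) (B k m))))"

end

(* For a set S of the conditioning sigma-algebra, the law of X restricted to S is the mixture of the
   conditional laws over S; comparing the first moments of these two measures shows that the
   conditional expectation of a reward given all actions is Q at its own action. By the tower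
   property, its expectation given act j alone is Q at act j if the reward belongs to index j, and V
   otherwise, because the actions are independent. The weights of the baseline add up to 1. *)

theory Submission
  imports Defs
begin

section \<open>Conditional expectations computed from conditional laws\<close>

text \<open>Both sides integrate \<open>f\<close> against a measure on \<open>N\<close>: the law of
  \<open>X\<close> under \<open>M\<close> restricted to \<open>S\<close>, and the mixture of the
  \<open>\<kappa> \<omega>\<close> over \<open>S\<close>. These measures agree on each
  \<open>B\<close> because \<open>law\<close> may be integrated over \<open>S\<close>. The null set
  in \<open>law\<close> may depend on \<open>B\<close>; after integration this does no harm, so no
  common null set has to be found.\<close>

lemma (in prob_space) nn_integral_conditional_law:
  assumes F: "subalgebra M F"
    and \<kappa>: "\<kappa> \<in> F \<rightarrow>\<^sub>M prob_algebra N"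
    and X [measurable]: "X \<in> M \<rightarrow>\<^sub>M N"
    and law: "\<And>B. B \<in> sets N \<Longrightarrow>
      AE \<omega> in M. real_cond_exp M F (indicator (X -` B \<inter> space M)) \<omega> = measure (\<kappa> \<omega>) B"
    and S: "S \<in> sets F"
    and f [measurable]: "f \<in> borel_measurable N"
  shows "(\<integral>\<^sup>+\<omega>. indicator S \<omega> * f (X \<omega>) \<partial>M) = (\<integral>\<^sup>+\<omega>. indicator S \<omega> * (\<integral>\<^sup>+x. f x \<partial>\<kappa> \<omega>) \<partial>M)"
proof -
  interpret F: finite_measure_subalgebra M F
    by unfold_locales (rule F)
  have S' [measurable]: "S \<in> sets M"
    using S F by (auto simp: subalgebra_def)
  have \<kappa>M: "\<kappa> \<in> M \<rightarrow>\<^sub>M prob_algebra N"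
    by (rule measurable_from_subalg[OF F \<kappa>])
  note \<kappa>s [measurable] = measurable_prob_algebraD[OF \<kappa>M]
  \<comment> \<open>\<open>P\<close> is the restriction of \<open>M\<close> to \<open>S\<close>,
    left unnormalised so that null sets \<open>S\<close> need no separate treatment.\<close>
  define P where "P = density M (indicator S)"
  have \<kappa>P: "\<kappa> \<in> P \<rightarrow>\<^sub>M subprob_algebra N"
    using \<kappa>s by (simp add: P_def)
  have XP: "X \<in> P \<rightarrow>\<^sub>M N"
    by (simp add: P_def)
  have ne: "space P \<noteq> {}"
    using not_empty by (simp add: P_def)
  have eq: "distr P N X = P \<bind> \<kappa>"
  proof (rule measure_eqI)
    show "sets (distr P N X) = sets (P \<bind> \<kappa>)"
      using sets_bind[OF subprob_measurableD(2)[OF \<kappa>P] ne] by simp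
    fix B assume "B \<in> sets (distr P N X)"
    then have B [measurable]: "B \<in> sets N" by simp
    have \<kappa>B [measurable]: "(\<lambda>\<omega>. measure (\<kappa> \<omega>) B) \<in> borel_measurable M"
      by (rule measurable_compose[OF \<kappa>s measurable_measure_subprob_algebra[OF B]])
    have XB [measurable]: "X -` B \<inter> space M \<in> sets M"
      by (rule measurable_sets[OF X B])
    have int: "integrable M (indicator (X -` B \<inter> space M) :: 'a \<Rightarrow> real)"
      by (simp add: emeasure_eq_measure)
    have "emeasure (distr P N X) B = emeasure M (S \<inter> (X -` B \<inter> space M))"
    proof -
      have "emeasure (distr P N X) B = emeasure P (X -` B \<inter> space M)"
        by (simp add: emeasure_distr[OF XP B]) (simp add: P_def)
      also have "\<dots> = (\<integral>\<^sup>+\<omega>. indicator (S \<inter> (X -` B \<inter> space M)) \<omega> \<partial>M)"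
        unfolding P_def
        by (subst emeasure_density)
          (measurable, rule nn_integral_cong, simp add: indicator_def)
      finally show ?thesis by simp
    qed
    also have "\<dots> = ennreal (\<integral>\<omega>\<in>S. indicator (X -` B \<inter> space M) \<omega> \<partial>M)"
      by (simp add: set_lebesgue_integral_def indicator_inter_arith[symmetric] emeasure_eq_measure)
    \<comment> \<open>Since \<open>S\<close> lies in \<open>F\<close>, the indicator may be replaced
      under the integral over \<open>S\<close> by its conditional expectation; \<open>law\<close>
      then replaces that by \<open>\<kappa>\<close>.\<close>
    also have "(\<integral>\<omega>\<in>S. indicator (X -` B \<inter> space M) \<omega> \<partial>M)
        = (\<integral>\<omega>\<in>S. real_cond_exp M F (indicator (X -` B \<inter> space M)) \<omega> \<partial>M)"
      by (rule F.real_cond_exp_intA[OF int S])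
    also have "\<dots> = (\<integral>\<omega>\<in>S. measure (\<kappa> \<omega>) B \<partial>M)"
      unfolding set_lebesgue_integral_def
      by (rule integral_cong_AE) (use law[OF B] in auto)
    also have "ennreal \<dots> = (\<integral>\<^sup>+\<omega>. ennreal (indicator S \<omega> * measure (\<kappa> \<omega>) B) \<partial>M)"
    proof -
      \<comment> \<open>The bound by 1 gives integrability, which is what allows the passage from
        the Bochner integral to the nonnegative integral.\<close>
      have "AE \<omega> in M. norm (indicator S \<omega> * measure (\<kappa> \<omega>) B) \<le> 1"
      proof (rule AE_I2)
        fix \<omega> assume "\<omega> \<in> space M"
        then interpret \<kappa>: prob_space "\<kappa> \<omega>"
          using measurable_space[OF \<kappa>M] by (simp add: space_prob_algebra)
        show "norm (indicator S \<omega> * measure (\<kappa> \<omega>) B) \<le> 1"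
          by (auto simp: indicator_def)
      qed
      then have "integrable M (\<lambda>\<omega>. indicator S \<omega> * measure (\<kappa> \<omega>) B)"
        by (intro integrable_const_bound[where B = 1]) auto
      then show ?thesis
        by (simp add: set_lebesgue_integral_def nn_integral_eq_integral)
    qed
    also have "\<dots> = (\<integral>\<^sup>+\<omega>. indicator S \<omega> * emeasure (\<kappa> \<omega>) B \<partial>M)"
    proof (rule nn_integral_cong)
      fix \<omega> assume "\<omega> \<in> space M"
      then interpret \<kappa>: prob_space "\<kappa> \<omega>"
        using measurable_space[OF \<kappa>M] by (simp add: space_prob_algebra)
      show "ennreal (indicator S \<omega> * measure (\<kappa> \<omega>) B) = indicator S \<omega> * emeasure (\<kappa> \<omega>) B"
        by (auto simp: indicator_def \<kappa>.emeasure_eq_measure)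
    qed
    also have "\<dots> = emeasure (P \<bind> \<kappa>) B"
      by (subst emeasure_bind[OF ne \<kappa>P B]) (simp add: P_def nn_integral_density)
    finally show "emeasure (distr P N X) B = emeasure (P \<bind> \<kappa>) B" .
  qed
  have "(\<integral>\<^sup>+\<omega>. indicator S \<omega> * f (X \<omega>) \<partial>M) = (\<integral>\<^sup>+x. f x \<partial>distr P N X)"
    by (subst nn_integral_distr[OF XP]) (simp_all add: P_def nn_integral_density)
  also have "\<dots> = (\<integral>\<^sup>+\<omega>. \<integral>\<^sup>+x. f x \<partial>\<kappa> \<omega> \<partial>P)"
    unfolding eq by (rule nn_integral_bind[OF f \<kappa>P])
  also have "\<dots> = (\<integral>\<^sup>+\<omega>. indicator S \<omega> * (\<integral>\<^sup>+x. f x \<partial>\<kappa> \<omega>) \<partial>M)"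
    unfolding P_def
    by (rule nn_integral_density)
      (auto intro: measurable_compose[OF \<kappa>s nn_integral_measurable_subprob_algebra[OF f]])
  finally show ?thesis .
qed

text \<open>The preceding identity is used twice: with \<open>S\<close> the whole space it shows
  that the kernel integral is integrable, and with arbitrary \<open>S\<close> in \<open>F\<close> it
  is the characterising property of the conditional expectation. Integrability of \<open>f\<close>
  under almost every \<open>\<kappa> \<omega>\<close> is recorded because the signed case has to
  subtract two such integrals.\<close>

lemma (in prob_space) real_cond_exp_conditional_law_nonneg:
  fixes f :: "'b \<Rightarrow> real"
  assumes F: "subalgebra M F"
    and \<kappa>: "\<kappa> \<in> F \<rightarrow>\<^sub>M prob_algebra N"
    and X [measurable]: "X \<in> M \<rightarrow>\<^sub>M N"
    and law: "\<And>B. B \<in> sets N \<Longrightarrow>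
      AE \<omega> in M. real_cond_exp M F (indicator (X -` B \<inter> space M)) \<omega> = measure (\<kappa> \<omega>) B"
    and f [measurable]: "f \<in> borel_measurable N"
    and nonneg: "\<And>x. 0 \<le> f x"
    and int: "integrable M (\<lambda>\<omega>. f (X \<omega>))"
  shows "integrable M (\<lambda>\<omega>. \<integral>x. f x \<partial>\<kappa> \<omega>)"
    and "AE \<omega> in M. integrable (\<kappa> \<omega>) f"
    and "AE \<omega> in M. real_cond_exp M F (\<lambda>\<omega>. f (X \<omega>)) \<omega> = (\<integral>x. f x \<partial>\<kappa> \<omega>)"
proof -
  interpret F: finite_measure_subalgebra M F
    by unfold_locales (rule F)
  have \<kappa>M: "\<kappa> \<in> M \<rightarrow>\<^sub>M prob_algebra N"
    by (rule measurable_from_subalg[OF F \<kappa>])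
  note \<kappa>F = measurable_prob_algebraD[OF \<kappa>]
  note \<kappa>s = measurable_prob_algebraD[OF \<kappa>M]
  have sets_\<kappa>: "sets (\<kappa> \<omega>) = sets N" if "\<omega> \<in> space M" for \<omega>
    using measurable_space[OF \<kappa>M that] by (simp add: space_prob_algebra)
  have f\<kappa>: "f \<in> borel_measurable (\<kappa> \<omega>)" if "\<omega> \<in> space M" for \<omega>
    using f by (simp add: measurable_cong_sets[OF sets_\<kappa>[OF that] refl])
  \<comment> \<open>\<open>p\<close> is the extended-valued integral. The Bochner integral is
    \<open>enn2real (p \<omega>)\<close>, which is 0 where \<open>p\<close> is infinite, so the two
    agree only after \<open>p\<close> is known to be finite almost everywhere.\<close>
  define p where "p \<omega> = (\<integral>\<^sup>+x. ennreal (f x) \<partial>\<kappa> \<omega>)" for \<omega>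
  have p [measurable]: "p \<in> borel_measurable M"
    unfolding p_def
    by (rule measurable_compose[OF \<kappa>s nn_integral_measurable_subprob_algebra]) simp
  have q: "(\<integral>x. f x \<partial>\<kappa> \<omega>) = enn2real (p \<omega>)" if "\<omega> \<in> space M" for \<omega>
    unfolding p_def by (rule integral_eq_nn_integral[OF f\<kappa>[OF that]]) (simp add: nonneg)
  have qF: "(\<lambda>\<omega>. \<integral>x. f x \<partial>\<kappa> \<omega>) \<in> borel_measurable F"
    by (rule measurable_compose[OF \<kappa>F integral_measurable_subprob_algebra[OF f]])
  have qM [measurable]: "(\<lambda>\<omega>. \<integral>x. f x \<partial>\<kappa> \<omega>) \<in> borel_measurable M"
    by (rule measurable_from_subalg[OF F qF])
  have transfer: "(\<integral>\<^sup>+\<omega>. indicator S \<omega> * ennreal (f (X \<omega>)) \<partial>M) = (\<integral>\<^sup>+\<omega>. indicator S \<omega> * p \<omega> \<partial>M)"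
    if "S \<in> sets F" for S
    unfolding p_def by (rule nn_integral_conditional_law[OF F \<kappa> X law that]) simp_all
  \<comment> \<open>The choice \<open>S = space F\<close> bounds the total mass of \<open>p\<close>
    by the finite integral of \<open>f (X \<omega>)\<close>.\<close>
  have "(\<integral>\<^sup>+\<omega>. p \<omega> \<partial>M) = (\<integral>\<^sup>+\<omega>. indicator (space F) \<omega> * p \<omega> \<partial>M)"
    using F by (intro nn_integral_cong) (simp add: subalgebra_def)
  also have "\<dots> = (\<integral>\<^sup>+\<omega>. indicator (space F) \<omega> * ennreal (f (X \<omega>)) \<partial>M)"
    by (rule transfer[symmetric]) simp
  also have "\<dots> = (\<integral>\<^sup>+\<omega>. ennreal (f (X \<omega>)) \<partial>M)"
    using F by (intro nn_integral_cong) (simp add: subalgebra_def)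
  also have "\<dots> < \<infinity>"
    using int nonneg by (simp add: nn_integral_eq_integral)
  finally have fin: "(\<integral>\<^sup>+\<omega>. p \<omega> \<partial>M) < \<infinity>" .
  have p_fin: "AE \<omega> in M. p \<omega> \<noteq> \<infinity>"
    using fin by (intro nn_integral_PInf_AE) auto
  have q_eq: "AE \<omega> in M. ennreal (\<integral>x. f x \<partial>\<kappa> \<omega>) = p \<omega>"
    using p_fin by (rule AE_mp) (auto intro!: AE_I2 simp: q less_top)
  have "(\<integral>\<^sup>+\<omega>. ennreal (\<integral>x. f x \<partial>\<kappa> \<omega>) \<partial>M) = (\<integral>\<^sup>+\<omega>. p \<omega> \<partial>M)"
    by (rule nn_integral_cong_AE[OF q_eq])
  then show int_q: "integrable M (\<lambda>\<omega>. \<integral>x. f x \<partial>\<kappa> \<omega>)"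
    using fin by (intro integrableI_nonneg) (auto intro!: AE_I2 Bochner_Integration.integral_nonneg nonneg)
  show "AE \<omega> in M. integrable (\<kappa> \<omega>) f"
    using p_fin
    by (rule AE_mp)
      (auto intro!: AE_I2 integrableI_nonneg f\<kappa> simp: nonneg p_def less_top)
  show "AE \<omega> in M. real_cond_exp M F (\<lambda>\<omega>. f (X \<omega>)) \<omega> = (\<integral>x. f x \<partial>\<kappa> \<omega>)"
  proof (rule F.real_cond_exp_charact[OF _ int int_q qF])
    fix S assume S: "S \<in> sets F"
    then have S' [measurable]: "S \<in> sets M"
      using F by (auto simp: subalgebra_def)
    \<comment> \<open>Both set integrals have nonnegative integrands, so they can be compared as
      nonnegative integrals, where \<open>transfer\<close> applies.\<close>
    have "(\<integral>\<omega>\<in>S. f (X \<omega>) \<partial>M) = enn2real (\<integral>\<^sup>+\<omega>. ennreal (indicator S \<omega> * f (X \<omega>)) \<partial>M)"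
      unfolding set_lebesgue_integral_def
      by (subst integral_eq_nn_integral) (auto simp: nonneg)
    also have "(\<integral>\<^sup>+\<omega>. ennreal (indicator S \<omega> * f (X \<omega>)) \<partial>M)
        = (\<integral>\<^sup>+\<omega>. indicator S \<omega> * ennreal (f (X \<omega>)) \<partial>M)"
      by (intro nn_integral_cong) (simp add: indicator_def)
    also have "\<dots> = (\<integral>\<^sup>+\<omega>. indicator S \<omega> * p \<omega> \<partial>M)"
      by (rule transfer[OF S])
    also have "\<dots> = (\<integral>\<^sup>+\<omega>. ennreal (indicator S \<omega> * (\<integral>x. f x \<partial>\<kappa> \<omega>)) \<partial>M)"
      by (rule nn_integral_cong_AE) (use q_eq in \<open>auto simp: indicator_def elim!: AE_mp\<close>)
    also have "enn2real \<dots> = (\<integral>\<omega>\<in>S. (\<integral>x. f x \<partial>\<kappa> \<omega>) \<partial>M)"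
      unfolding set_lebesgue_integral_def real_scaleR_def
      by (rule integral_eq_nn_integral[symmetric])
        (auto intro!: AE_I2 mult_nonneg_nonneg Bochner_Integration.integral_nonneg nonneg)
    finally show "(\<integral>\<omega>\<in>S. f (X \<omega>) \<partial>M) = (\<integral>\<omega>\<in>S. (\<integral>x. f x \<partial>\<kappa> \<omega>) \<partial>M)" .
  qed
qed

text \<open>The nonnegative case is applied to the positive and negative parts of \<open>f\<close>,
  both of which are integrable along \<open>X\<close>.\<close>

lemma (in prob_space) real_cond_exp_conditional_law:
  fixes f :: "'b \<Rightarrow> real"
  assumes F: "subalgebra M F"
    and \<kappa>: "\<kappa> \<in> F \<rightarrow>\<^sub>M prob_algebra N"
    and X [measurable]: "X \<in> M \<rightarrow>\<^sub>M N"
    and law: "\<And>B. B \<in> sets N \<Longrightarrow>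
      AE \<omega> in M. real_cond_exp M F (indicator (X -` B \<inter> space M)) \<omega> = measure (\<kappa> \<omega>) B"
    and f [measurable]: "f \<in> borel_measurable N"
    and int: "integrable M (\<lambda>\<omega>. f (X \<omega>))"
  shows "integrable M (\<lambda>\<omega>. \<integral>x. f x \<partial>\<kappa> \<omega>)"
    and "AE \<omega> in M. real_cond_exp M F (\<lambda>\<omega>. f (X \<omega>)) \<omega> = (\<integral>x. f x \<partial>\<kappa> \<omega>)"
proof -
  interpret F: finite_measure_subalgebra M F
    by unfold_locales (rule F)
  have qM [measurable]: "(\<lambda>\<omega>. \<integral>x. f x \<partial>\<kappa> \<omega>) \<in> borel_measurable M"
    by (rule measurable_from_subalg[OF F])
      (rule measurable_compose[OF measurable_prob_algebraD[OF \<kappa>]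
          integral_measurable_subprob_algebra[OF f]])
  define fp where "fp x = max 0 (f x)" for x
  define fn where "fn x = max 0 (- f x)" for x
  have f_eq: "f = (\<lambda>x. fp x - fn x)"
    by (auto simp: fp_def fn_def)
  have [measurable]: "fp \<in> borel_measurable N" "fn \<in> borel_measurable N"
    by (simp_all add: fp_def[abs_def] fn_def[abs_def])
  have ints: "integrable M (\<lambda>\<omega>. fp (X \<omega>))" "integrable M (\<lambda>\<omega>. fn (X \<omega>))"
    unfolding fp_def fn_def using int by auto
  note p = real_cond_exp_conditional_law_nonneg[OF F \<kappa> X law, of fp]
  note n = real_cond_exp_conditional_law_nonneg[OF F \<kappa> X law, of fn]
  have pos: "\<And>x. 0 \<le> fp x" "\<And>x. 0 \<le> fn x"
    by (auto simp: fp_def fn_def)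
  \<comment> \<open>The Bochner integral is additive here only where both parts are integrable under
    \<open>\<kappa> \<omega>\<close>, hence an almost-everywhere statement.\<close>
  have split: "AE \<omega> in M. (\<integral>x. f x \<partial>\<kappa> \<omega>) = (\<integral>x. fp x \<partial>\<kappa> \<omega>) - (\<integral>x. fn x \<partial>\<kappa> \<omega>)"
    using p(2) n(2) pos ints by (auto simp: f_eq)
  have "integrable M (\<lambda>\<omega>. (\<integral>x. fp x \<partial>\<kappa> \<omega>) - (\<integral>x. fn x \<partial>\<kappa> \<omega>))"
    using p(1) n(1) pos ints by auto
  then show "integrable M (\<lambda>\<omega>. \<integral>x. f x \<partial>\<kappa> \<omega>)"
    by (rule integrable_cong_AE_imp) (use split in auto)
  have "AE \<omega> in M. real_cond_exp M F (\<lambda>\<omega>. f (X \<omega>)) \<omega>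
      = real_cond_exp M F (\<lambda>\<omega>. fp (X \<omega>)) \<omega> - real_cond_exp M F (\<lambda>\<omega>. fn (X \<omega>)) \<omega>"
    unfolding f_eq by (rule F.real_cond_exp_diff[OF ints])
  moreover have "AE \<omega> in M. real_cond_exp M F (\<lambda>\<omega>. fp (X \<omega>)) \<omega> = (\<integral>x. fp x \<partial>\<kappa> \<omega>)"
    using p(3) pos ints by auto
  moreover have "AE \<omega> in M. real_cond_exp M F (\<lambda>\<omega>. fn (X \<omega>)) \<omega> = (\<integral>x. fn x \<partial>\<kappa> \<omega>)"
    using n(3) pos ints by auto
  ultimately show "AE \<omega> in M. real_cond_exp M F (\<lambda>\<omega>. f (X \<omega>)) \<omega> = (\<integral>x. f x \<partial>\<kappa> \<omega>)"
    using split by eventually_elim simp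
qed

section \<open>Conditioning on a random variable, independence and linearity\<close>

lemma subalgebra_vimage_algebra:
  assumes "X \<in> M \<rightarrow>\<^sub>M N"
  shows "subalgebra M (vimage_algebra (space M) X N)"
  unfolding subalgebra_def
  using assms by (auto simp: sets_vimage_algebra2[OF funcsetI[OF measurable_space[OF assms]]])

text \<open>Every set of the conditioning sigma-algebra is a preimage under \<open>X\<close>, so its
  indicator is a function of \<open>X\<close>. The expectation of its product with
  \<open>g (Y \<omega>)\<close> therefore factorises, and the constant passes the test for a
  conditional expectation.\<close>

lemma (in prob_space) real_cond_exp_indep_var:
  fixes g :: "'b \<Rightarrow> real"
  assumes indep: "indep_var N X N' Y"
    and g: "g \<in> borel_measurable N'"
    and int: "integrable M (\<lambda>\<omega>. g (Y \<omega>))"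
  shows "AE \<omega> in M. real_cond_exp M (vimage_algebra (space M) X N) (\<lambda>\<omega>. g (Y \<omega>)) \<omega> = expectation (\<lambda>\<omega>. g (Y \<omega>))"
proof -
  let ?F = "vimage_algebra (space M) X N"
  have X [measurable]: "X \<in> M \<rightarrow>\<^sub>M N"
    by (rule indep_var_rv1[OF indep])
  interpret F: finite_measure_subalgebra M ?F
    by unfold_locales (rule subalgebra_vimage_algebra[OF X])
  show ?thesis
  proof (rule F.real_cond_exp_charact[OF _ int])
    fix S assume "S \<in> sets ?F"
    then obtain E where E [measurable]: "E \<in> sets N" and S: "S = X -` E \<inter> space M"
      by (auto simp: sets_vimage_algebra2[OF funcsetI[OF measurable_space[OF X]]])
    have ind: "(indicator S \<omega> :: real) = indicator E (X \<omega>)" if "\<omega> \<in> space M" for \<omega>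
      using that by (simp add: S indicator_def)
    have "indep_var borel ((indicator E :: _ \<Rightarrow> real) \<circ> X) borel (g \<circ> Y)"
      by (rule indep_var_compose[OF indep]) (simp_all add: g)
    moreover have ind_int: "integrable M (\<lambda>\<omega>. indicator E (X \<omega>) :: real)"
      by (rule integrable_const_bound[where B = 1]) simp_all
    ultimately have prod: "expectation (\<lambda>\<omega>. indicator E (X \<omega>) * g (Y \<omega>))
        = expectation (\<lambda>\<omega>. indicator E (X \<omega>)) * expectation (\<lambda>\<omega>. g (Y \<omega>))"
      using indep_var_lebesgue_integral[of "indicator E \<circ> X" "g \<circ> Y"] int ind_int
      by (simp only: comp_def)
    have "(\<integral>\<omega>\<in>S. g (Y \<omega>) \<partial>M) = expectation (\<lambda>\<omega>. indicator E (X \<omega>) * g (Y \<omega>))"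
      unfolding set_lebesgue_integral_def by (rule Bochner_Integration.integral_cong) (simp_all add: ind)
    also have "\<dots> = expectation (\<lambda>\<omega>. indicator S \<omega> * expectation (\<lambda>\<omega>. g (Y \<omega>)))"
      using prod by (simp add: ind cong: Bochner_Integration.integral_cong)
    finally show "(\<integral>\<omega>\<in>S. g (Y \<omega>) \<partial>M) = (\<integral>\<omega>\<in>S. expectation (\<lambda>\<omega>. g (Y \<omega>)) \<partial>M)"
      by (simp add: set_lebesgue_integral_def)
  qed simp_all
qed

lemma (in prob_space) indep_var_of_indep_vars:
  assumes "indep_vars N X I" "i \<in> I" "j \<in> I" "i \<noteq> j"
  shows "indep_var (N i) (X i) (N j) (X j)"
proof -
  \<comment> \<open>The singletons of \<open>i\<close> and \<open>j\<close> are disjoint blocks of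
    indices; evaluating each restricted family at its one coordinate recovers \<open>X i\<close> and
    \<open>X j\<close>.\<close>
  have "indep_var (Pi\<^sub>M {i} N) (\<lambda>\<omega>. restrict (\<lambda>i. X i \<omega>) {i}) (Pi\<^sub>M {j} N) (\<lambda>\<omega>. restrict (\<lambda>i. X i \<omega>) {j})"
    using assms by (intro indep_var_restrict[OF assms(1)]) auto
  then have "indep_var (N i) ((\<lambda>f. f i) \<circ> (\<lambda>\<omega>. restrict (\<lambda>i. X i \<omega>) {i}))
      (N j) ((\<lambda>f. f j) \<circ> (\<lambda>\<omega>. restrict (\<lambda>i. X i \<omega>) {j}))"
    by (rule indep_var_compose) auto
  then show ?thesis
    by (simp add: comp_def)
qed

lemma (in sigma_finite_subalgebra) real_cond_exp_lincomb:
  fixes f :: "'i \<Rightarrow> 'a \<Rightarrow> real"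
  assumes fin: "finite I"
    and int: "\<And>i. i \<in> I \<Longrightarrow> integrable M (f i)"
    and ce: "\<And>i. i \<in> I \<Longrightarrow> AE x in M. real_cond_exp M F (f i) x = g i x"
  shows "AE x in M. real_cond_exp M F (\<lambda>x. \<Sum>i\<in>I. a i * f i x) x = (\<Sum>i\<in>I. a i * g i x)"
proof -
  \<comment> \<open>Extension by zero outside \<open>I\<close> makes every \<open>f' i\<close>
    integrable, as \<open>real_cond_exp_sum\<close> asks for all indices.\<close>
  define f' where "f' i = (if i \<in> I then (\<lambda>x. a i * f i x) else (\<lambda>_. 0))" for i
  have "AE x in M. real_cond_exp M F (\<lambda>x. \<Sum>i\<in>I. f' i x) x = (\<Sum>i\<in>I. real_cond_exp M F (f' i) x)"
    by (rule real_cond_exp_sum) (simp add: f'_def int)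
  moreover have "AE x in M. \<forall>i\<in>I. real_cond_exp M F (f' i) x = a i * g i x"
  proof (rule AE_finite_allI[OF fin])
    fix i assume i: "i \<in> I"
    show "AE x in M. real_cond_exp M F (f' i) x = a i * g i x"
      using real_cond_exp_cmult[OF int[OF i], of "a i"] ce[OF i]
      by eventually_elim (simp add: f'_def i)
  qed
  ultimately show ?thesis
    by eventually_elim (simp add: f'_def cong: sum.cong)
qed

section \<open>Conditional expectation of a single reward\<close>

text \<open>The joint product formula is reduced to its marginal for \<open>R k m\<close>, which
  says that \<open>K (act k \<omega>)\<close> is the conditional law of this reward given all
  actions. Its mean is then the conditional expectation.\<close>

lemma (in prob_space) real_cond_exp_reward_given_actions:
  assumes K: "K \<in> A \<rightarrow>\<^sub>M prob_algebra borel"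
    and act: "\<And>k. k \<in> {1..n} \<Longrightarrow> act k \<in> M \<rightarrow>\<^sub>M A"
    and rollouts: "independent_rollouts_given_actions M A K n c act R"
    and k: "k \<in> {1..n}" and m: "m \<in> {1..c k}"
    and int: "integrable M (R k m)"
  shows "integrable M (\<lambda>\<omega>. \<integral>r. r \<partial>K (act k \<omega>))"
    and "AE \<omega> in M. cond_exp_given M (Pi\<^sub>M {1..n} (\<lambda>_. A)) (\<lambda>\<omega>'. \<lambda>k\<in>{1..n}. act k \<omega>') (R k m) \<omega>
           = (\<integral>r. r \<partial>K (act k \<omega>))"
proof -
  let ?acts = "\<lambda>\<omega>'. \<lambda>k\<in>{1..n}. act k \<omega>'"
  let ?F = "vimage_algebra (space M) ?acts (Pi\<^sub>M {1..n} (\<lambda>_. A))"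
  have acts: "?acts \<in> M \<rightarrow>\<^sub>M Pi\<^sub>M {1..n} (\<lambda>_. A)"
    by (intro measurable_restrict act)
  note F = subalgebra_vimage_algebra[OF acts]
  \<comment> \<open>As \<open>k\<close> lies in the index range, coordinate \<open>k\<close> of the
    restricted tuple is \<open>act k\<close>; hence the kernel depends measurably on the
    conditioning tuple.\<close>
  have "(\<lambda>\<omega>. ?acts \<omega> k) \<in> ?F \<rightarrow>\<^sub>M A"
    by (rule measurable_compose[OF measurable_vimage_algebra1 measurable_component_singleton[OF k]])
      (use measurable_space[OF acts] in blast)
  then have \<kappa>: "(\<lambda>\<omega>. K (act k \<omega>)) \<in> ?F \<rightarrow>\<^sub>M prob_algebra borel"
    using k by (intro measurable_compose[OF _ K]) simp
  have law: "AE \<omega> in M. real_cond_exp M ?F (indicator (R k m -` B \<inter> space M)) \<omega>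
      = measure (K (act k \<omega>)) B" if B: "B \<in> sets borel" for B
  proof -
    \<comment> \<open>Only \<open>R k m\<close> is constrained. All other factors of the product are
      masses of the whole line under probability measures, that is, 1.\<close>
    define B' where "B' k' m' = (if k' = k \<and> m' = m then B else UNIV)" for k' m'
    have "AE \<omega> in M. real_cond_exp M ?F
        (indicator {\<omega>' \<in> space M. \<forall>k\<in>{1..n}. \<forall>m\<in>{1..c k}. R k m \<omega>' \<in> B' k m}) \<omega>
        = (\<Prod>k' = 1..n. \<Prod>m' = 1..c k'. measure (K (act k' \<omega>)) (B' k' m'))"
      using rollouts B
      unfolding independent_rollouts_given_actions_def cond_exp_given_def
      by (auto simp: B'_def)
    moreover have "{\<omega>' \<in> space M. \<forall>k\<in>{1..n}. \<forall>m\<in>{1..c k}. R k m \<omega>' \<in> B' k m}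
        = R k m -` B \<inter> space M"
      using k m by (auto simp: B'_def)
    moreover have "(\<Prod>k' = 1..n. \<Prod>m' = 1..c k'. measure (K (act k' \<omega>)) (B' k' m'))
        = measure (K (act k \<omega>)) B" if \<omega>: "\<omega> \<in> space M" for \<omega>
    proof -
      have one: "measure (K (act k' \<omega>)) UNIV = 1" if "k' \<in> {1..n}" for k'
      proof -
        have "K (act k' \<omega>) \<in> space (prob_algebra borel)"
          by (rule measurable_space[OF K measurable_space[OF act[OF that] \<omega>]])
        then show ?thesis
          by (metis (mono_tags, lifting) mem_Collect_eq prob_space.prob_space sets_eq_imp_space_eq
              space_borel space_prob_algebra)
      qed
      have "(\<Prod>m' = 1..c k'. measure (K (act k' \<omega>)) (B' k' m'))
          = (if k' = k then measure (K (act k \<omega>)) B else 1)" if "k' \<in> {1..n}" for k'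
      proof -
        have "(\<Prod>m' = 1..c k'. measure (K (act k' \<omega>)) (B' k' m'))
            = (\<Prod>m' = 1..c k'. if m' = m then (if k' = k then measure (K (act k \<omega>)) B else 1) else 1)"
          by (rule prod.cong) (auto simp: B'_def one[OF k] one[OF that])
        also have "\<dots> = (if k' = k then measure (K (act k \<omega>)) B else 1)"
          using m by (auto simp: prod.delta)
        finally show ?thesis .
      qed
      then have "(\<Prod>k' = 1..n. \<Prod>m' = 1..c k'. measure (K (act k' \<omega>)) (B' k' m'))
          = (\<Prod>k' = 1..n. if k' = k then measure (K (act k \<omega>)) B else 1)"
        by (intro prod.cong) auto
      also have "\<dots> = measure (K (act k \<omega>)) B"
        using k by (simp add: prod.delta)
      finally show ?thesis .
    qed
    ultimately show ?thesis
      by (auto elim!: AE_mp intro!: AE_I2)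
  qed
  note * = real_cond_exp_conditional_law[OF F \<kappa> borel_measurable_integrable[OF int] law, of "\<lambda>r. r"]
  show "integrable M (\<lambda>\<omega>. \<integral>r. r \<partial>K (act k \<omega>))"
    using *(1) int by simp
  show "AE \<omega> in M. cond_exp_given M (Pi\<^sub>M {1..n} (\<lambda>_. A)) ?acts (R k m) \<omega>
      = (\<integral>r. r \<partial>K (act k \<omega>))"
    unfolding cond_exp_given_def using *(2) int by simp
qed

text \<open>Tower property: conditioning first on all actions turns the reward into a function of
  \<open>act k\<close>. Given \<open>act j\<close>, this function is already known if
  \<open>k = j\<close>; otherwise independence of the actions leaves its mean.\<close>

lemma (in prob_space) real_cond_exp_reward_given_action:
  assumes K: "K \<in> A \<rightarrow>\<^sub>M prob_algebra borel"
    and act: "\<And>k. k \<in> {1..n} \<Longrightarrow> act k \<in> M \<rightarrow>\<^sub>M A"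
    and indep: "indep_vars (\<lambda>_. A) act {1..n}"
    and rollouts: "independent_rollouts_given_actions M A K n c act R"
    and k: "k \<in> {1..n}" and m: "m \<in> {1..c k}" and j: "j \<in> {1..n}"
    and int: "integrable M (R k m)"
  shows "AE \<omega> in M. cond_exp_given M A (act j) (R k m) \<omega>
    = (if k = j then \<integral>r. r \<partial>K (act j \<omega>) else \<integral>a. (\<integral>r. r \<partial>K a) \<partial>distr M A (act k))"
proof -
  let ?acts = "\<lambda>\<omega>'. \<lambda>k\<in>{1..n}. act k \<omega>'"
  let ?F = "vimage_algebra (space M) ?acts (Pi\<^sub>M {1..n} (\<lambda>_. A))"
  let ?G = "vimage_algebra (space M) (act j) A"
  let ?Q = "\<lambda>a. \<integral>r. r \<partial>K a"
  have acts: "?acts \<in> M \<rightarrow>\<^sub>M Pi\<^sub>M {1..n} (\<lambda>_. A)"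
    by (intro measurable_restrict act)
  note F = subalgebra_vimage_algebra[OF acts] and G = subalgebra_vimage_algebra[OF act[OF j]]
  interpret F: finite_measure_subalgebra M ?F
    by unfold_locales (rule F)
  interpret G: finite_measure_subalgebra M ?G
    by unfold_locales (rule G)
  have "(\<lambda>\<omega>. ?acts \<omega> j) \<in> ?F \<rightarrow>\<^sub>M A"
    by (rule measurable_compose[OF measurable_vimage_algebra1 measurable_component_singleton[OF j]])
      (use measurable_space[OF acts] in blast)
  then have "act j \<in> ?F \<rightarrow>\<^sub>M A"
    using j by simp
  \<comment> \<open>Since \<open>act j\<close> is measurable for the sigma-algebra of the whole
    tuple, its own sigma-algebra is contained in that one; this is the nesting needed by the tower
    property.\<close>
  from subalgebra_vimage_algebra[OF this] have GF: "subalgebra ?F ?G"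
    by simp
  have Q [measurable]: "?Q \<in> borel_measurable A"
    by (rule measurable_compose[OF measurable_prob_algebraD[OF K] integral_measurable_subprob_algebra]) simp
  note reward = real_cond_exp_reward_given_actions[OF K act rollouts k m int, unfolded cond_exp_given_def]
  have "AE \<omega> in M. real_cond_exp M ?G (R k m) \<omega> = real_cond_exp M ?G (real_cond_exp M ?F (R k m)) \<omega>"
    using G.real_cond_exp_nested_subalg[OF F GF int] by eventually_elim simp
  moreover have "AE \<omega> in M. real_cond_exp M ?G (real_cond_exp M ?F (R k m)) \<omega>
      = real_cond_exp M ?G (\<lambda>\<omega>. ?Q (act k \<omega>)) \<omega>"
    by (rule G.real_cond_exp_cong)
      (use reward borel_measurable_integrable[OF reward(1)] in auto)
  moreover have "AE \<omega> in M. real_cond_exp M ?G (\<lambda>\<omega>. ?Q (act k \<omega>)) \<omega>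
      = (if k = j then ?Q (act j \<omega>) else \<integral>a. ?Q a \<partial>distr M A (act k))"
  proof (cases "k = j")
    case True
    have "act j \<in> ?G \<rightarrow>\<^sub>M A"
      by (rule measurable_vimage_algebra1) (use measurable_space[OF act[OF j]] in blast)
    then have "(\<lambda>\<omega>. ?Q (act j \<omega>)) \<in> borel_measurable ?G"
      by (rule measurable_compose[OF _ Q])
    from G.real_cond_exp_F_meas[OF _ this] show ?thesis
      using reward(1) True by simp
  next
    case False
    have "indep_var A (act j) A (act k)"
      using indep_var_of_indep_vars[OF indep j k] False by simp
    from real_cond_exp_indep_var[OF this Q reward(1)] show ?thesis
      using False by (simp add: integral_distr[OF act[OF k] Q])
  qed
  ultimately show ?thesis
    unfolding cond_exp_given_def by eventually_elim simp
qed

section \<open>Unbiasedness of the leave-one-out advantage\<close>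

theorem proposition2:
  fixes M :: "'w measure"
    and A :: "'a measure"
    and \<pi>\<^sub>b :: "'h \<Rightarrow> 'a measure"
    and D\<^sub>b :: "'h \<Rightarrow> 'a \<Rightarrow> real measure"
    and h\<^sub>u :: 'h
    and n :: nat
    and c :: "nat \<Rightarrow> nat"
    and act :: "nat \<Rightarrow> 'w \<Rightarrow> 'a"
    and R :: "nat \<Rightarrow> nat \<Rightarrow> 'w \<Rightarrow> real"
  assumes "prob_space M"
    and "\<pi>\<^sub>b h\<^sub>u \<in> space (prob_algebra A)"
    and "D\<^sub>b h\<^sub>u \<in> A \<rightarrow>\<^sub>M prob_algebra borel"
    and "n \<ge> 2"
    and "\<forall>k\<in>{1..n}. c k \<ge> 1"
    and "\<forall>k\<in>{1..n}. act k \<in> M \<rightarrow>\<^sub>M A"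
    and "\<forall>k\<in>{1..n}. distr M A (act k) = \<pi>\<^sub>b h\<^sub>u"
    and "prob_space.indep_vars M (\<lambda>_. A) act {1..n}"
    and "\<forall>k\<in>{1..n}. \<forall>m\<in>{1..c k}. integrable M (R k m)"
    and "independent_rollouts_given_actions M A (D\<^sub>b h\<^sub>u) n c act R"
  shows "\<forall>j\<in>{1..n}.
           integrable M (loo_advantage n c R j) \<and>
           (AE \<omega> in M. cond_exp_given M A (act j) (loo_advantage n c R j) \<omega>
                        = target_advantage \<pi>\<^sub>b D\<^sub>b h\<^sub>u (act j \<omega>))"
proof
  fix j assume j: "j \<in> {1..n}"
  interpret prob_space M by fact
  let ?F = "vimage_algebra (space M) (act j) A"
  let ?Q = "Q_value D\<^sub>b h\<^sub>u" and ?V = "V_value \<pi>\<^sub>b D\<^sub>b h\<^sub>u"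
  let ?S = "real (total_count n c) - real (c j)"
  have act: "\<And>k. k \<in> {1..n} \<Longrightarrow> act k \<in> M \<rightarrow>\<^sub>M A"
    using assms by blast
  interpret F: finite_measure_subalgebra M ?F
    by unfold_locales (rule subalgebra_vimage_algebra[OF act[OF j]])
  have c_pos: "real (c k) > 0" if "k \<in> {1..n}" for k
    using assms(5) that by fastforce
  have int_R: "integrable M (R k m)" if "k \<in> {1..n}" "m \<in> {1..c k}" for k m
    using assms(9) that by blast
  \<comment> \<open>The common action law \<open>\<pi>\<^sub>b h\<^sub>u\<close> turns the mean over
    \<open>distr M A (act k)\<close> into the value \<open>?V\<close>.\<close>
  have ce_R: "AE \<omega> in M. real_cond_exp M ?F (R k m) \<omega> = (if k = j then ?Q (act j \<omega>) else ?V)"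
    if k: "k \<in> {1..n}" and m: "m \<in> {1..c k}" for k m
    using real_cond_exp_reward_given_action[OF assms(3) act assms(8,10) k m j int_R[OF k m]] bspec[OF assms(7) k]
    by (simp only: cond_exp_given_def Q_value_def V_value_def)
  have Q_hat_eq: "Q_hat c R k = (\<lambda>\<omega>. \<Sum>m = 1..c k. (1 / real (c k)) * R k m \<omega>)" for k
    by (simp add: Q_hat_def fun_eq_iff sum_distrib_left)
  have int_Q: "integrable M (Q_hat c R k)" if "k \<in> {1..n}" for k
    unfolding Q_hat_eq using int_R that by auto
  \<comment> \<open>All \<open>c k\<close> rewards of index \<open>k\<close> have the same
    conditional expectation, so their average has it too; \<open>c k\<close> is positive, so the
    factor \<open>1 / real (c k)\<close> cancels.\<close>
  have ce_Q: "AE \<omega> in M. real_cond_exp M ?F (Q_hat c R k) \<omega> = (if k = j then ?Q (act j \<omega>) else ?V)"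
    if k: "k \<in> {1..n}" for k
  proof -
    have "AE \<omega> in M. real_cond_exp M ?F (Q_hat c R k) \<omega>
        = (\<Sum>m = 1..c k. (1 / real (c k)) * (if k = j then ?Q (act j \<omega>) else ?V))"
      unfolding Q_hat_eq by (rule F.real_cond_exp_lincomb) (use int_R ce_R k in auto)
    then show ?thesis
      using c_pos[OF k] by simp
  qed
  have b_eq: "loo_baseline n c R j = (\<lambda>\<omega>. \<Sum>k\<in>{1..n} - {j}. (real (c k) / ?S) * Q_hat c R k \<omega>)"
    by (simp add: loo_baseline_def fun_eq_iff sum_distrib_left)
  have int_b: "integrable M (loo_baseline n c R j)"
    unfolding b_eq using int_Q by auto
  have S_eq: "?S = (\<Sum>k\<in>{1..n} - {j}. real (c k))"
    using j by (simp add: total_count_def sum_diff1)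
  \<comment> \<open>With \<open>n\<close> at least 2 some other index remains, so the denominator
    \<open>?S\<close> is a nonempty sum of positive counts. A zero denominator would make the
    baseline 0 by the convention for division.\<close>
  have "card ({1..n} - {j}) \<noteq> 0"
    using j assms(4) by simp
  then have ne: "{1..n} - {j} \<noteq> {}"
    by (metis card.empty)
  have S_pos: "?S > 0"
    unfolding S_eq by (rule sum_pos[OF _ ne c_pos]) simp_all
  have ce_b: "AE \<omega> in M. real_cond_exp M ?F (loo_baseline n c R j) \<omega> = ?V"
  proof -
    have "AE \<omega> in M. real_cond_exp M ?F (loo_baseline n c R j) \<omega>
        = (\<Sum>k\<in>{1..n} - {j}. (real (c k) / ?S) * ?V)"
      unfolding b_eq
    proof (rule F.real_cond_exp_lincomb)
      fix k assume k: "k \<in> {1..n} - {j}"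
      then show "integrable M (Q_hat c R k)"
        by (intro int_Q) simp
      show "AE \<omega> in M. real_cond_exp M ?F (Q_hat c R k) \<omega> = ?V"
        using ce_Q[of k] k by simp
    qed simp
    \<comment> \<open>The weights \<open>real (c k) / ?S\<close> sum to 1, so unequal rollout counts
      introduce no bias.\<close>
    moreover have "(\<Sum>k\<in>{1..n} - {j}. (real (c k) / ?S) * ?V) = ?V"
      unfolding sum_distrib_right[symmetric] sum_divide_distrib[symmetric] S_eq[symmetric]
      using S_pos by simp
    ultimately show ?thesis by simp
  qed
  have adv_eq: "loo_advantage n c R j = (\<lambda>\<omega>. Q_hat c R j \<omega> - loo_baseline n c R j \<omega>)"
    by (simp add: loo_advantage_def fun_eq_iff)
  have "AE \<omega> in M. cond_exp_given M A (act j) (loo_advantage n c R j) \<omega>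
      = target_advantage \<pi>\<^sub>b D\<^sub>b h\<^sub>u (act j \<omega>)"
    using F.real_cond_exp_diff[OF int_Q[OF j] int_b] ce_Q[OF j] ce_b
    unfolding cond_exp_given_def adv_eq target_advantage_def
    by eventually_elim simp
  \<comment> \<open>Integrability ensures that the totally defined \<open>real_cond_exp\<close> is
    here the conditional expectation in the usual sense.\<close>
  moreover have "integrable M (loo_advantage n c R j)"
    unfolding adv_eq using int_Q[OF j] int_b by simp
  ultimately show "integrable M (loo_advantage n c R j) \<and>
      (AE \<omega> in M. cond_exp_given M A (act j) (loo_advantage n c R j) \<omega>
        = target_advantage \<pi>\<^sub>b D\<^sub>b h\<^sub>u (act j \<omega>))"
    by blast
qed

end
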